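(* Let $Alg$ be a Strassen-like matrix multiplication algorithm with base case $n_0\times n_0$ using $m$ multiplications, where $\omega_0=\log_{n_0} m$ satisfies $2<\omega_0<3$, and whose base decoding graph $Dec_1C$ is connected. Then there exist constants $c>0$ and $c_0\ge1$, depending only on the base case, with the following property. For every $M\ge1$ and every power $n$ of $n_0$ with $n\ge c_0\sqrt M$, every implementation of $Alg$ on $n\times n$ matrices in the sequential two-level memory model with fast memory of size $M$, without recomputation, moves at least $$c\left(\frac{n}{\sqrt M}\right)^{\omega_0} M$$ words. That is, $IO(n)=\Omega\big((n/\sqrt M)^{\omega_0}M\big)$.
   Context: Strassen-like algorithm: fix a bilinear algorithm multiplying two $n_0\times n_0$ matrices with $m$ multiplications. It forms $m$ linear combinations $L_r(A)$ of entries of $A$ and $m$ linear combinations $L'_r(B)$ of entries of $B$, computes $P_r=L_r(A)L'_r(B)$ for $r=1,\dots,m$, and outputs each $C_{ij}$ as a linear combination of the $P_r$. For $n$ a power of $n_0$, the algorithm on $n\times n$ matrices proceeds as follows: - Split $A,B$ into $n_0^2$ blocks of size $\frac{n}{n_0}\times\frac{n}{n_0}$. - Form the same linear combinations of blocks, computed entrywise by binary scalar additions, subtractions and scalar multiplications. - Multiply the $m$ block pairs by recursive calls; for $n=1$ use a scalar multiplication. - Combine the block products into the blocks of $C$ via the same linear combinations, again entrywise. The base decoding graph $Dec_1C$ is the bipartite graph on the $m$ product vertices $P_1,\dots,P_m$ and the $n_0^2$ output vertices $C_{ij}$. It has an edge $C_{ij}P_r$ iff $P_r$ has a nonzero coefficient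 in the expression of $C_{ij}$. Strassen's algorithm ($n_0=2$, $m=7$) and Winograd's variant satisfy the connectivity hypothesis; the classical algorithm does not. Computation graph (CDAG): a directed acyclic graph with one vertex per input entry and one vertex per scalar arithmetic operation. There is an edge $(u,v)$ whenever the value of $u$ is an operand of the operation $v$. Sequential two-level memory model: - There is a fast memory holding at most $M$ words and an unbounded slow memory. - Inputs start in slow memory, and outputs must end in slow memory. - Arithmetic operations require their operands to be in fast memory and place their results there. - Each word read from slow to fast memory, or written from fast to slow memory, costs one unit. An implementation computes every CDAG vertex exactly once (no recomputation), in an order consistent with the edges. $IO(n)$ is the minimum number of words moved over all implementations. *)

theory Defs
  imports Complex_Main
begin

section \<open>Base case of a Strassen-like (bilinear) algorithm\<close>

text \<open>Straight-line programs used to evaluate the linear combinations of the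
base case entrywise.  Slots 0..<N are the inputs; instruction t produces slot N+t.\<close>

datatype instr = Add nat nat | Sub nat nat | Scal real nat

fun ins_ops :: "instr \<Rightarrow> nat list" where
  "ins_ops (Add a b) = [a, b]"
| "ins_ops (Sub a b) = [a, b]"
| "ins_ops (Scal c a) = [a]"

fun ins_eval :: "instr \<Rightarrow> real list \<Rightarrow> real" where
  "ins_eval (Add a b) vs = vs ! a + vs ! b"
| "ins_eval (Sub a b) vs = vs ! a - vs ! b"
| "ins_eval (Scal c a) vs = c * vs ! a"

definition prog_vals :: "nat \<Rightarrow> instr list \<Rightarrow> (nat \<Rightarrow> real) \<Rightarrow> real list" where
  "prog_vals N p x = fold (\<lambda>i vs. vs @ [ins_eval i vs]) p (map x [0..<N])"

definition prog_wf :: "nat \<Rightarrow> instr list \<Rightarrow> (nat \<Rightarrow> nat) \<Rightarrow> nat \<Rightarrow> bool" where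
  "prog_wf N p outs K \<longleftrightarrow>
     (\<forall>t < length p. \<forall>a \<in> set (ins_ops (p ! t)). a < N + t) \<and>
     (\<forall>r < K. outs r < N + length p)"

text \<open>The program with output map outs computes the K linear forms
  x \<mapsto> \<Sum>s<N. coef r s * x s  (r < K).\<close>
definition computes :: "nat \<Rightarrow> instr list \<Rightarrow> (nat \<Rightarrow> nat) \<Rightarrow> nat \<Rightarrow> (nat \<Rightarrow> nat \<Rightarrow> real) \<Rightarrow> bool" where
  "computes N p outs K coef \<longleftrightarrow> prog_wf N p outs K \<and>
     (\<forall>x. \<forall>r < K. prog_vals N p x ! outs r = (\<Sum>s<N. coef r s * x s))"

text \<open>A base case: n0, m, the coefficients of L_r(A) (coefA r i j), of L'_r(B)
  (coefB r i j), and of P_r in C_ij (coefC i j r), together with the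
  straight-line programs (binary additions, subtractions, scalar multiplications)
  by which these linear combinations are evaluated.  Block (i,j) of an n0 x n0
  block matrix corresponds to slot i*n0+j.\<close>

record scheme =
  bn0 :: nat
  bm :: nat
  coefA :: "nat \<Rightarrow> nat \<Rightarrow> nat \<Rightarrow> real"
  coefB :: "nat \<Rightarrow> nat \<Rightarrow> nat \<Rightarrow> real"
  coefC :: "nat \<Rightarrow> nat \<Rightarrow> nat \<Rightarrow> real"
  encA :: "instr list"
  outA :: "nat \<Rightarrow> nat"
  encB :: "instr list"
  outB :: "nat \<Rightarrow> nat"
  dec :: "instr list"
  outD :: "nat \<Rightarrow> nat"

definition is_mm_alg :: "scheme \<Rightarrow> bool" where
  "is_mm_alg S \<longleftrightarrow> (\<forall>(A::nat \<Rightarrow> nat \<Rightarrow> real) (B::nat \<Rightarrow> nat \<Rightarrow> real).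
     \<forall>i < bn0 S. \<forall>j < bn0 S.
       (\<Sum>r < bm S. coefC S i j r
          * (\<Sum>k < bn0 S. \<Sum>l < bn0 S. coefA S r k l * A k l)
          * (\<Sum>k < bn0 S. \<Sum>l < bn0 S. coefB S r k l * B k l))
       = (\<Sum>k < bn0 S. A i k * B k j))"

definition strassen_like :: "scheme \<Rightarrow> bool" where
  "strassen_like S \<longleftrightarrow> is_mm_alg S \<and>
     computes (bn0 S ^ 2) (encA S) (outA S) (bm S)
       (\<lambda>r s. coefA S r (s div bn0 S) (s mod bn0 S)) \<and>
     computes (bn0 S ^ 2) (encB S) (outB S) (bm S)
       (\<lambda>r s. coefB S r (s div bn0 S) (s mod bn0 S)) \<and>
     computes (bm S) (dec S) (outD S) (bn0 S ^ 2)
       (\<lambda>s r. coefC S (s div bn0 S) (s mod bn0 S) r)"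

section \<open>The base decoding graph Dec_1 C\<close>

definition dec1_verts :: "scheme \<Rightarrow> (nat + nat \<times> nat) set" where
  "dec1_verts S = Inl ` {..<bm S} \<union> Inr ` ({..<bn0 S} \<times> {..<bn0 S})"

definition dec1_edges :: "scheme \<Rightarrow> ((nat + nat \<times> nat) \<times> (nat + nat \<times> nat)) set" where
  "dec1_edges S = {(Inl r, Inr (i, j)) | r i j.
      r < bm S \<and> i < bn0 S \<and> j < bn0 S \<and> coefC S i j r \<noteq> 0}"

definition dec1_connected :: "scheme \<Rightarrow> bool" where
  "dec1_connected S \<longleftrightarrow> (\<forall>u \<in> dec1_verts S. \<forall>v \<in> dec1_verts S.
      (u, v) \<in> (dec1_edges S \<union> (dec1_edges S)\<inverse>)\<^sup>*)"

section \<open>The CDAG of the recursive algorithm on n x n matrices, n = n0^k\<close>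

text \<open>Recursion nodes are identified by paths ps (list of product indices,
  most recent choice first).  Vertices:
  VA i j / VB i j: input entries;
  EA ps t p q / EB ps t p q: entry (p,q) of the result of instruction t of the
    encoding program at node ps;
  Mul ps: scalar multiplication at leaf ps;
  D ps t p q: entry (p,q) of instruction t of the decoding program at node ps.\<close>

datatype vtx = VA nat nat | VB nat nat
  | EA "nat list" nat nat nat | EB "nat list" nat nat nat
  | Mul "nat list" | D "nat list" nat nat nat

text \<open>Vertex holding entry (i,j) of the A-operand at node ps (depth k total).\<close>
fun aval :: "scheme \<Rightarrow> nat \<Rightarrow> nat list \<Rightarrow> nat \<Rightarrow> nat \<Rightarrow> vtx" where
  "aval S k [] i j = VA i j"
| "aval S k (r # ps) p q =
    (let n0 = bn0 S; sz = n0 ^ (k - Suc (length ps)); s = outA S r in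
     if s < n0 ^ 2 then aval S k ps ((s div n0) * sz + p) ((s mod n0) * sz + q)
     else EA ps (s - n0 ^ 2) p q)"

fun bval :: "scheme \<Rightarrow> nat \<Rightarrow> nat list \<Rightarrow> nat \<Rightarrow> nat \<Rightarrow> vtx" where
  "bval S k [] i j = VB i j"
| "bval S k (r # ps) p q =
    (let n0 = bn0 S; sz = n0 ^ (k - Suc (length ps)); s = outB S r in
     if s < n0 ^ 2 then bval S k ps ((s div n0) * sz + p) ((s mod n0) * sz + q)
     else EB ps (s - n0 ^ 2) p q)"

text \<open>Vertex holding entry (p,q) of slot s of the encoding program at node ps.\<close>
definition slotA :: "scheme \<Rightarrow> nat \<Rightarrow> nat list \<Rightarrow> nat \<Rightarrow> nat \<Rightarrow> nat \<Rightarrow> vtx" where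
  "slotA S k ps s p q =
    (let n0 = bn0 S; sz = n0 ^ (k - Suc (length ps)) in
     if s < n0 ^ 2 then aval S k ps ((s div n0) * sz + p) ((s mod n0) * sz + q)
     else EA ps (s - n0 ^ 2) p q)"

definition slotB :: "scheme \<Rightarrow> nat \<Rightarrow> nat list \<Rightarrow> nat \<Rightarrow> nat \<Rightarrow> nat \<Rightarrow> vtx" where
  "slotB S k ps s p q =
    (let n0 = bn0 S; sz = n0 ^ (k - Suc (length ps)) in
     if s < n0 ^ 2 then bval S k ps ((s div n0) * sz + p) ((s mod n0) * sz + q)
     else EB ps (s - n0 ^ 2) p q)"

text \<open>Vertex holding entry (i,j) of the product computed at node ps,
  where d is the remaining recursion depth below ps.\<close>
fun cval :: "scheme \<Rightarrow> nat \<Rightarrow> nat list \<Rightarrow> nat \<Rightarrow> nat \<Rightarrow> vtx" where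
  "cval S 0 ps i j = Mul ps"
| "cval S (Suc d) ps i j =
    (let n0 = bn0 S; sz = n0 ^ d; s = outD S ((i div sz) * n0 + j div sz) in
     if s < bm S then cval S d (s # ps) (i mod sz) (j mod sz)
     else D ps (s - bm S) (i mod sz) (j mod sz))"

text \<open>Vertex holding entry (p,q) of slot s of the decoding program at node ps
  (d = remaining depth below the children of ps).\<close>
definition slotD :: "scheme \<Rightarrow> nat \<Rightarrow> nat list \<Rightarrow> nat \<Rightarrow> nat \<Rightarrow> nat \<Rightarrow> vtx" where
  "slotD S d ps s p q =
    (if s < bm S then cval S d (s # ps) p q else D ps (s - bm S) p q)"

definition nodes :: "scheme \<Rightarrow> nat \<Rightarrow> nat list set" where
  "nodes S l = {ps. length ps = l \<and> set ps \<subseteq> {..<bm S}}"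

definition cdag_V :: "scheme \<Rightarrow> nat \<Rightarrow> vtx set" where
  "cdag_V S k =
     {VA i j | i j. i < bn0 S ^ k \<and> j < bn0 S ^ k} \<union>
     {VB i j | i j. i < bn0 S ^ k \<and> j < bn0 S ^ k} \<union>
     {EA ps t p q | ps t p q. length ps < k \<and> ps \<in> nodes S (length ps) \<and>
        t < length (encA S) \<and> p < bn0 S ^ (k - Suc (length ps)) \<and> q < bn0 S ^ (k - Suc (length ps))} \<union>
     {EB ps t p q | ps t p q. length ps < k \<and> ps \<in> nodes S (length ps) \<and>
        t < length (encB S) \<and> p < bn0 S ^ (k - Suc (length ps)) \<and> q < bn0 S ^ (k - Suc (length ps))} \<union>
     {Mul ps | ps. ps \<in> nodes S k} \<union>
     {D ps t p q | ps t p q. length ps < k \<and> ps \<in> nodes S (length ps) \<and>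
        t < length (dec S) \<and> p < bn0 S ^ (k - Suc (length ps)) \<and> q < bn0 S ^ (k - Suc (length ps))}"

definition cdag_I :: "scheme \<Rightarrow> nat \<Rightarrow> vtx set" where
  "cdag_I S k =
     {VA i j | i j. i < bn0 S ^ k \<and> j < bn0 S ^ k} \<union>
     {VB i j | i j. i < bn0 S ^ k \<and> j < bn0 S ^ k}"

definition cdag_O :: "scheme \<Rightarrow> nat \<Rightarrow> vtx set" where
  "cdag_O S k = {cval S k [] i j | i j. i < bn0 S ^ k \<and> j < bn0 S ^ k}"

text \<open>Operands (in-neighbours) of each vertex: edge (u,v) iff u \<in> cdag_preds S k v.\<close>
fun cdag_preds :: "scheme \<Rightarrow> nat \<Rightarrow> vtx \<Rightarrow> vtx set" where
  "cdag_preds S k (VA i j) = {}"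
| "cdag_preds S k (VB i j) = {}"
| "cdag_preds S k (EA ps t p q) = (\<lambda>s. slotA S k ps s p q) ` set (ins_ops (encA S ! t))"
| "cdag_preds S k (EB ps t p q) = (\<lambda>s. slotB S k ps s p q) ` set (ins_ops (encB S ! t))"
| "cdag_preds S k (Mul ps) = {aval S k ps 0 0, bval S k ps 0 0}"
| "cdag_preds S k (D ps t p q) =
     (\<lambda>s. slotD S (k - Suc (length ps)) ps s p q) ` set (ins_ops (dec S ! t))"

section \<open>Sequential two-level memory model, no recomputation\<close>

datatype 'v step = Rd 'v | Wr 'v | Cmp 'v | Del 'v

text \<open>State: (fast memory contents, slow memory contents, vertices computed so far).\<close>
fun exec_step :: "nat \<Rightarrow> 'v set \<Rightarrow> 'v set \<Rightarrow> ('v \<Rightarrow> 'v set) \<Rightarrow>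
    'v set \<times> 'v set \<times> 'v set \<Rightarrow> 'v step \<Rightarrow> ('v set \<times> 'v set \<times> 'v set) option" where
  "exec_step M V I pr (F, Sl, C) (Rd v) =
     (if v \<in> Sl \<and> card (insert v F) \<le> M then Some (insert v F, Sl, C) else None)"
| "exec_step M V I pr (F, Sl, C) (Wr v) =
     (if v \<in> F then Some (F, insert v Sl, C) else None)"
| "exec_step M V I pr (F, Sl, C) (Cmp v) =
     (if v \<in> V \<and> v \<notin> I \<and> v \<notin> C \<and> pr v \<subseteq> F \<and> card (insert v F) \<le> M
      then Some (insert v F, Sl, insert v C) else None)"
| "exec_step M V I pr (F, Sl, C) (Del v) = Some (F - {v}, Sl, C)"

fun exec_steps :: "nat \<Rightarrow> 'v set \<Rightarrow> 'v set \<Rightarrow> ('v \<Rightarrow> 'v set) \<Rightarrow>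
    'v set \<times> 'v set \<times> 'v set \<Rightarrow> 'v step list \<Rightarrow> ('v set \<times> 'v set \<times> 'v set) option" where
  "exec_steps M V I pr st [] = Some st"
| "exec_steps M V I pr st (x # xs) =
     (case exec_step M V I pr st x of None \<Rightarrow> None | Some st' \<Rightarrow> exec_steps M V I pr st' xs)"

text \<open>A valid implementation: starting with empty fast memory and the inputs in slow
  memory, every non-input vertex is computed exactly once and all outputs end in
  slow memory.\<close>
definition valid_impl :: "nat \<Rightarrow> 'v set \<Rightarrow> 'v set \<Rightarrow> 'v set \<Rightarrow> ('v \<Rightarrow> 'v set) \<Rightarrow> 'v step list \<Rightarrow> bool" where
  "valid_impl M V I Out pr sch \<longleftrightarrow>
     (\<exists>F Sl C. exec_steps M V I pr ({}, I, {}) sch = Some (F, Sl, C) \<and> C = V - I \<and> Out \<subseteq> Sl)"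

fun is_io :: "'v step \<Rightarrow> bool" where
  "is_io (Rd v) = True"
| "is_io (Wr v) = True"
| "is_io (Cmp v) = False"
| "is_io (Del v) = False"

definition io_cost :: "'v step list \<Rightarrow> nat" where
  "io_cost sch = length (filter is_io sch)"

end

theory Submission
  imports Defs
begin

text \<open>Cut the schedule into segments computing half of \<open>m ^ d\<close> scalar products each, where
  \<open>n0 ^ (2 * d)\<close> is about \<open>M\<close>, and colour the vertices by whether they are computed in the segment.
  In every subtree of depth \<open>d\<close>, join each scalar product \<open>(r\<^sub>1, \<dots>, r\<^sub>d)\<close> to each output entry
  \<open>(c\<^sub>1, \<dots>, c\<^sub>d)\<close> by exchanging one coordinate at a time, each exchange taking place inside one copy
  of the connected base decoding graph. A pair with different colours crosses a two-coloured copy, and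
  such a copy contains the tail of a two-coloured edge. At most half of the products of a subtree are
  in the segment, so whatever the colour of an output, it forms a two-coloured pair with at least as
  many products as are in the segment. A copy at level \<open>j\<close> serves \<open>m ^ (d - j + 1) * n0 ^ (2 * j)\<close> pairs,
  a geometric sum over \<open>j\<close>, so the segment has at least \<open>3 * M\<close> boundary vertices. Of these at
  most \<open>2 * M\<close> sit in fast memory at its start or end, and each of the others is moved.\<close>

section \<open>Segments of an execution\<close>

text \<open>Invariant of every execution. Finiteness is required because \<open>card\<close> of an
  infinite set is \<open>0\<close>; the clause on \<open>Sl\<close> ensures that a vertex computed
  in a segment was not stored before it.\<close>

fun state_ok :: "nat \<Rightarrow> 'v set \<Rightarrow> 'v set \<Rightarrow> 'v set \<times> 'v set \<times> 'v set \<Rightarrow> bool" where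
  "state_ok M V I (F, Sl, C) \<longleftrightarrow>
     finite F \<and> card F \<le> M \<and> F \<subseteq> I \<union> C \<and> Sl \<subseteq> I \<union> C \<and> C \<subseteq> V - I"

lemma exec_step_ok:
  assumes "exec_step M V I pr st x = Some st'" "state_ok M V I st"
  shows "state_ok M V I st'"
proof -
  obtain F Sl C where "st = (F, Sl, C)" by (cases st)
  then show ?thesis using assms
    by (cases x) (auto split: if_splits intro: le_trans[OF card_Diff1_le])
qed

lemma exec_steps_ok:
  assumes "exec_steps M V I pr st xs = Some st'" "state_ok M V I st"
  shows "state_ok M V I st'"
  using assms by (induction xs arbitrary: st) (auto split: option.splits dest: exec_step_ok)

lemma exec_steps_append:
  "exec_steps M V I pr st (xs @ ys) =
     (case exec_steps M V I pr st xs of None \<Rightarrow> None | Some st' \<Rightarrow> exec_steps M V I pr st' ys)"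
  by (induction xs arbitrary: st) (auto split: option.splits)

text \<open>A discrete intermediate value argument: one step computes at most one vertex, so the
  number of computed vertices of \<open>L\<close> passes through \<open>K\<close>.\<close>

lemma exec_steps_split:
  assumes "exec_steps M V I pr (F, Sl, C) xs = Some (F', Sl', C')"
    and "finite L" "K \<le> card (L \<inter> (C' - C))"
  obtains ys zs F1 Sl1 C1 where "xs = ys @ zs"
    "exec_steps M V I pr (F, Sl, C) ys = Some (F1, Sl1, C1)"
    "exec_steps M V I pr (F1, Sl1, C1) zs = Some (F', Sl', C')"
    "card (L \<inter> (C1 - C)) = K"
proof -
  have "\<exists>ys zs F1 Sl1 C1. xs = ys @ zs \<and> exec_steps M V I pr (F, Sl, C) ys = Some (F1, Sl1, C1) \<and>
    exec_steps M V I pr (F1, Sl1, C1) zs = Some (F', Sl', C') \<and> card (L \<inter> (C1 - C)) = K"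
    using assms(1,3)
  proof (induction xs arbitrary: F' Sl' C' rule: rev_induct)
    case Nil
    then show ?case by force
  next
    case (snoc x xs)
    from snoc.prems(1) obtain F2 Sl2 C2 where
      st: "exec_steps M V I pr (F, Sl, C) xs = Some (F2, Sl2, C2)"
      and step: "exec_step M V I pr (F2, Sl2, C2) x = Some (F', Sl', C')"
      by (auto simp: exec_steps_append split: option.splits)
    show ?case
    proof (cases "K \<le> card (L \<inter> (C2 - C))")
      case True
      with snoc.IH[OF st] obtain ys zs F1 Sl1 C1 where *: "xs = ys @ zs"
        "exec_steps M V I pr (F, Sl, C) ys = Some (F1, Sl1, C1)"
        "exec_steps M V I pr (F1, Sl1, C1) zs = Some (F2, Sl2, C2)" "card (L \<inter> (C1 - C)) = K"
        by blast
      then have "exec_steps M V I pr (F1, Sl1, C1) (zs @ [x]) = Some (F', Sl', C')"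
        using step by (simp add: exec_steps_append)
      with * show ?thesis by (intro exI[of _ ys] exI[of _ "zs @ [x]"]) auto
    next
      case False
      have "\<exists>v. C' \<subseteq> insert v C2"
        using step by (cases x) (auto split: if_splits)
      then obtain v where "C' \<subseteq> insert v C2" by blast
      then have "card (L \<inter> (C' - C)) \<le> card (insert v (L \<inter> (C2 - C)))"
        using assms(2) by (intro card_mono) auto
      also have "\<dots> \<le> Suc (card (L \<inter> (C2 - C)))"
        by (simp add: assms(2) card_insert_if)
      finally have "card (L \<inter> (C' - C)) = K" using False snoc.prems(2) by simp
      with snoc.prems(1) show ?thesis
        by (intro exI[of _ "xs @ [x]"] exI[of _ "[]"]) auto
    qed
  qed
  then show ?thesis using that by blast
qed

section \<open>Movement of operands across a segment\<close>

lemma exec_steps_computed_mono: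
  assumes "exec_steps M V I pr (F, Sl, C) xs = Some (F', Sl', C')"
  shows "C \<subseteq> C'"
  using assms
proof (induction xs arbitrary: F Sl C)
  case (Cons x xs)
  then obtain F1 Sl1 C1 where "exec_step M V I pr (F, Sl, C) x = Some (F1, Sl1, C1)"
    "exec_steps M V I pr (F1, Sl1, C1) xs = Some (F', Sl', C')"
    by (auto split: option.splits)
  moreover from this(1) have "C \<subseteq> C1" by (cases x) (auto split: if_splits)
  ultimately show ?case using Cons.IH by blast
qed simp

text \<open>Computing \<open>v\<close> needs \<open>u\<close> in fast memory, and since
  \<open>u\<close> is not computed in this run, it was there at the start or was read.\<close>

lemma operands_loaded:
  assumes "exec_steps M V I pr (F, Sl, C) xs = Some (F', Sl', C')"
    and "v \<in> C' - C" "u \<in> pr v" "u \<notin> C' - C"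
  shows "u \<in> F \<or> Rd u \<in> set xs"
  using assms
proof (induction xs arbitrary: F Sl C)
  case (Cons x xs)
  then obtain F1 Sl1 C1 where st: "exec_step M V I pr (F, Sl, C) x = Some (F1, Sl1, C1)"
    "exec_steps M V I pr (F1, Sl1, C1) xs = Some (F', Sl', C')"
    by (auto split: option.splits)
  note mono = exec_steps_computed_mono[OF st(2)]
  show ?case
  proof (cases "v \<in> C1")
    case True
    with st(1) Cons.prems show ?thesis by (cases x) (auto split: if_splits)
  next
    case False
    have "u \<notin> C' - C1" using st(1) Cons.prems(4) by (cases x) (auto split: if_splits)
    with Cons.IH[OF st(2)] False Cons.prems have "u \<in> F1 \<or> Rd u \<in> set xs" by auto
    with st(1) mono Cons.prems(4) show ?thesis by (cases x) (auto split: if_splits)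
  qed
qed simp

lemma written_if_stored:
  assumes "exec_steps M V I pr (F, Sl, C) xs = Some (F', Sl', C')" "u \<in> Sl'" "u \<notin> Sl"
  shows "Wr u \<in> set xs"
  using assms
proof (induction xs arbitrary: F Sl C)
  case (Cons x xs)
  then obtain F1 Sl1 C1 where st: "exec_step M V I pr (F, Sl, C) x = Some (F1, Sl1, C1)"
    "exec_steps M V I pr (F1, Sl1, C1) xs = Some (F', Sl', C')"
    by (auto split: option.splits)
  with Cons show ?case by (cases x) (auto split: if_splits)
qed simp

text \<open>Here the ban on recomputation enters: a computed vertex held in neither memory is lost
  for good.\<close>

lemma lost_not_read:
  assumes "exec_steps M V I pr (F, Sl, C) xs = Some (F', Sl', C')" "u \<in> C" "u \<notin> F" "u \<notin> Sl"
  shows "Rd u \<notin> set xs"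
  using assms
proof (induction xs arbitrary: F Sl C)
  case (Cons x xs)
  then obtain F1 Sl1 C1 where st: "exec_step M V I pr (F, Sl, C) x = Some (F1, Sl1, C1)"
    "exec_steps M V I pr (F1, Sl1, C1) xs = Some (F', Sl', C')"
    by (auto split: option.splits)
  with Cons show ?case by (cases x) (auto split: if_splits)
qed simp

lemma card_io_le:
  "finite {u. Rd u \<in> set xs \<or> Wr u \<in> set xs} \<and> card {u. Rd u \<in> set xs \<or> Wr u \<in> set xs} \<le> io_cost xs"
proof -
  let ?f = "\<lambda>x. case x of Rd u \<Rightarrow> u | Wr u \<Rightarrow> u | Cmp u \<Rightarrow> u | Del u \<Rightarrow> u"
  have sub: "{u. Rd u \<in> set xs \<or> Wr u \<in> set xs} \<subseteq> set (map ?f (filter is_io xs))"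
    by force
  then have "card {u. Rd u \<in> set xs \<or> Wr u \<in> set xs} \<le> card (set (map ?f (filter is_io xs)))"
    by (rule card_mono[rotated]) simp
  also have "\<dots> \<le> io_cost xs" unfolding io_cost_def
    by (metis card_length length_map)
  finally show ?thesis using finite_subset[OF sub] by simp
qed

lemma io_cost_append [simp]: "io_cost (xs @ ys) = io_cost xs + io_cost ys"
  by (simp add: io_cost_def)

text \<open>A boundary vertex of a segment is resident at its start or end, or is moved during it.\<close>

lemma segment_io:
  assumes ok: "state_ok M V I (F, Sl, C)"
    and seg: "exec_steps M V I pr (F, Sl, C) ys = Some (F1, Sl1, C1)"
    and rest: "exec_steps M V I pr (F1, Sl1, C1) zs = Some (F', Sl', V - I)"
    and closed: "\<And>v. v \<in> C \<Longrightarrow> pr v \<subseteq> I \<union> C"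
    and large: "\<And>\<delta>. finite \<delta> \<Longrightarrow>
       (\<And>u v. v \<in> V - I \<Longrightarrow> u \<in> pr v - I \<Longrightarrow> (u \<in> C1 - C) \<noteq> (v \<in> C1 - C) \<Longrightarrow> u \<in> \<delta>) \<Longrightarrow>
       3 * M \<le> card \<delta>"
  shows "M \<le> io_cost ys"
proof -
  let ?\<delta> = "F \<union> F1 \<union> {u. Rd u \<in> set ys \<or> Wr u \<in> set ys}"
  have ok1: "state_ok M V I (F1, Sl1, C1)" using exec_steps_ok[OF seg ok] .
  have "u \<in> ?\<delta>" if v: "v \<in> V - I" and u: "u \<in> pr v - I" and ne: "(u \<in> C1 - C) \<noteq> (v \<in> C1 - C)" for u v
  proof (cases "v \<in> C1 - C")
    case True
    with operands_loaded[OF seg True] u ne show ?thesis by blast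
  next
    case False
    \<comment> \<open>Now \<open>u\<close> is computed in the segment and \<open>v\<close> is not.
      As \<open>v\<close> cannot precede its operand, it is computed afterwards, so \<open>u\<close>
      must survive the segment.\<close>
    with ne have uC: "u \<in> C1" "u \<notin> C" by auto
    then have "v \<notin> C" using closed[of v] u by auto
    with False v have v': "v \<in> (V - I) - C1" by auto
    have "u \<in> F1 \<or> u \<in> Sl1"
      using operands_loaded[OF rest v'] u uC lost_not_read[OF rest, of u] by blast
    moreover have "u \<notin> Sl" using ok u uC by auto
    ultimately show ?thesis using written_if_stored[OF seg, of u] by blast
  qed
  moreover have "finite ?\<delta>" using ok ok1 card_io_le[of ys] by auto
  ultimately have "3 * M \<le> card ?\<delta>" by (intro large) auto
  also have "\<dots> \<le> card F + card F1 + card {u. Rd u \<in> set ys \<or> Wr u \<in> set ys}"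
    by (intro order_trans[OF card_Un_le] add_mono) auto
  also have "\<dots> \<le> 2 * M + io_cost ys" using ok ok1 card_io_le[of ys] by auto
  finally show ?thesis by simp
qed

lemma exec_steps_closed:
  assumes "exec_steps M V I pr (F, Sl, C) xs = Some (F', Sl', C')"
    and "state_ok M V I (F, Sl, C)" and "\<And>v. v \<in> C \<Longrightarrow> pr v \<subseteq> I \<union> C" and "v \<in> C'"
  shows "pr v \<subseteq> I \<union> C'"
  using assms
proof (induction xs arbitrary: F Sl C)
  case (Cons x xs)
  then obtain F1 Sl1 C1 where st: "exec_step M V I pr (F, Sl, C) x = Some (F1, Sl1, C1)"
    "exec_steps M V I pr (F1, Sl1, C1) xs = Some (F', Sl', C')"
    by (auto split: option.splits)
  have "pr w \<subseteq> I \<union> C1" if "w \<in> C1" for w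
    using that st(1) Cons.prems(2) Cons.prems(3)[of w] by (cases x) (auto split: if_splits)
  with Cons.IH[OF st(2) exec_step_ok[OF st(1) Cons.prems(2)]] Cons.prems(4) show ?case by blast
qed auto

text \<open>Peel off \<open>q\<close> segments that each compute exactly \<open>K\<close> vertices
  of \<open>L\<close>. By \<open>large\<close> each of them costs \<open>M\<close>; what remains of
  the schedule is ignored.\<close>

lemma io_lower_bound:
  assumes valid: "valid_impl M V I Out pr sch"
    and L: "finite L" "L \<subseteq> V - I" "q * K \<le> card L"
    and large: "\<And>T \<delta>. card (L \<inter> T) = K \<Longrightarrow> finite \<delta> \<Longrightarrow>
       (\<And>u v. v \<in> V - I \<Longrightarrow> u \<in> pr v - I \<Longrightarrow> (u \<in> T) \<noteq> (v \<in> T) \<Longrightarrow> u \<in> \<delta>) \<Longrightarrow>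
       3 * M \<le> card \<delta>"
  shows "q * M \<le> io_cost sch"
proof -
  have gen: "q * M \<le> io_cost xs"
    if "exec_steps M V I pr (F, Sl, C) xs = Some (F', Sl', V - I)"
      "state_ok M V I (F, Sl, C)" "\<And>v. v \<in> C \<Longrightarrow> pr v \<subseteq> I \<union> C" "q * K \<le> card (L - C)"
    for q xs F Sl C F' Sl'
    using that
  proof (induction q arbitrary: xs F Sl C)
    case (Suc q)
    have "L \<inter> ((V - I) - C) = L - C" using L by auto
    with Suc.prems(4) have "K \<le> card (L \<inter> ((V - I) - C))" by simp
    from exec_steps_split[OF Suc.prems(1) L(1) this] obtain ys zs F1 Sl1 C1 where
      xs: "xs = ys @ zs" and ys: "exec_steps M V I pr (F, Sl, C) ys = Some (F1, Sl1, C1)"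
      and zs: "exec_steps M V I pr (F1, Sl1, C1) zs = Some (F', Sl', V - I)"
      and K: "card (L \<inter> (C1 - C)) = K" .
    have "M \<le> io_cost ys"
      by (rule segment_io[OF Suc.prems(2) ys zs Suc.prems(3)]) (use K large in blast)+
    moreover have "q * M \<le> io_cost zs"
    proof (rule Suc.IH[OF zs exec_steps_ok[OF ys Suc.prems(2)]])
      show "pr v \<subseteq> I \<union> C1" if "v \<in> C1" for v
        by (rule exec_steps_closed[OF ys Suc.prems(2,3) that])
      have "L - C = (L - C1) \<union> (L \<inter> (C1 - C))"
        using exec_steps_computed_mono[OF ys] by auto
      then have "card (L - C) \<le> card (L - C1) + K"
        using card_Un_le[of "L - C1" "L \<inter> (C1 - C)"] K by simp
      with Suc.prems(4) show "q * K \<le> card (L - C1)" by simp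
    qed
    ultimately show ?case using xs by simp
  qed simp
  from valid obtain F' Sl' where "exec_steps M V I pr ({}, I, {}) sch = Some (F', Sl', V - I)"
    by (auto simp: valid_impl_def)
  then show ?thesis by (rule gen) (use L in auto)
qed

section \<open>Copies of the base decoding graph\<close>

lemma prog_vals_snoc:
  "prog_vals N (p @ [i]) x = prog_vals N p x @ [ins_eval i (prog_vals N p x)]"
  by (simp add: prog_vals_def)

lemma length_prog_vals [simp]: "length (prog_vals N p x) = N + length p"
  by (induction p rule: rev_induct) (simp_all add: prog_vals_snoc, simp add: prog_vals_def)

lemma ins_eval_cong:
  "(\<And>a. a \<in> set (ins_ops i) \<Longrightarrow> vs ! a = ws ! a) \<Longrightarrow> ins_eval i vs = ins_eval i ws"
  by (cases i) auto

text \<open>No instruction mixes colours, so a slot depends only on inputs of its own colour, and on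
  those \<open>x\<close> and \<open>y\<close> agree.\<close>

lemma prog_vals_colour:
  assumes "\<forall>t < length p. \<forall>a \<in> set (ins_ops (p ! t)). a < N + t \<and> f a = f (N + t)"
    and "\<And>s. s < N \<Longrightarrow> f s \<noteq> b \<Longrightarrow> x s = y s"
    and "s < N + length p" "f s \<noteq> b"
  shows "prog_vals N p x ! s = prog_vals N p y ! s"
  using assms(1,3,4)
proof (induction p arbitrary: s rule: rev_induct)
  case Nil
  then show ?case using assms(2) by (simp add: prog_vals_def)
next
  case (snoc i p)
  have wf: "\<forall>t < length p. \<forall>a \<in> set (ins_ops (p ! t)). a < N + t \<and> f a = f (N + t)"
  proof (intro allI impI)
    fix t assume "t < length p"
    then show "\<forall>a \<in> set (ins_ops (p ! t)). a < N + t \<and> f a = f (N + t)"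
      using snoc.prems(1)[rule_format, of t] by (auto simp: nth_append)
  qed
  show ?case
  proof (cases "s < N + length p")
    case True
    then show ?thesis using snoc.IH[OF wf True] snoc.prems by (simp add: prog_vals_snoc nth_append)
  next
    case False
    then have s: "s = N + length p" using snoc.prems by simp
    have "a < N + length p \<and> f a = f s" if "a \<in> set (ins_ops i)" for a
      using snoc.prems(1)[rule_format, of "length p" a] that s by simp
    then have "ins_eval i (prog_vals N p x) = ins_eval i (prog_vals N p y)"
      using snoc.IH[OF wf] snoc.prems(3) by (intro ins_eval_cong) auto
    then show ?thesis by (simp add: prog_vals_snoc nth_append s)
  qed
qed

text \<open>Replaces the path from slot \<open>r\<close> to the output in the program graph: if their colours differed,
  changing \<open>x r\<close> alone would not change the output.\<close>

lemma computes_colour: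
  assumes comp: "computes N p outs K coef"
    and col: "\<And>t a. t < length p \<Longrightarrow> a \<in> set (ins_ops (p ! t)) \<Longrightarrow> f a = f (N + t)"
    and r: "r < N" "e < K" "coef e r \<noteq> 0"
  shows "f (outs e) = (f r :: bool)"
proof (rule ccontr)
  assume ne: "f (outs e) \<noteq> f r"
  let ?x = "\<lambda>s. if s = r then 1 else 0 :: real"
  have "prog_vals N p ?x ! outs e = prog_vals N p (\<lambda>_. 0) ! outs e"
    using comp col ne r
    by (intro prog_vals_colour[where f = f and b = "f r"]) (auto simp: computes_def prog_wf_def)
  then have "(\<Sum>s<N. coef e s * ?x s) = 0"
    using comp r by (simp add: computes_def)
  then show False using r by (simp add: if_distrib[of "\<lambda>x. _ * x"] cong: if_cong)
qed

lemma div_mod_block: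
  assumes "b < (n :: nat)"
  shows "(a * n + b) div n = a" "(a * n + b) mod n = b"
  using assms by auto

lemma block_less:
  assumes "a < n" "b < (N :: nat)"
  shows "a * N + b < n * N"
proof -
  have "a * N + b < Suc a * N" using assms by simp
  also have "\<dots> \<le> n * N" using assms by (intro mult_le_mono1) simp
  finally show ?thesis .
qed

text \<open>Colour each output entry like its slot. By \<open>computes_colour\<close> every edge of
  the base graph joins equal colours, and connectivity does the rest.\<close>

lemma dec_colour:
  assumes S: "strassen_like S" "dec1_connected S"
    and col: "\<And>t a. t < length (dec S) \<Longrightarrow> a \<in> set (ins_ops (dec S ! t)) \<Longrightarrow> f a = f (bm S + t)"
    and r: "r < bm S" "i < bn0 S" "j < bn0 S"
  shows "f (outD S (i * bn0 S + j)) = (f r :: bool)"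
proof -
  let ?g = "case_sum f (\<lambda>(i, j). f (outD S (i * bn0 S + j)))"
  have comp: "computes (bm S) (dec S) (outD S) (bn0 S ^ 2)
       (\<lambda>s r. coefC S (s div bn0 S) (s mod bn0 S) r)"
    using S by (simp add: strassen_like_def)
  have edge: "?g u = ?g v" if "(u, v) \<in> dec1_edges S \<union> (dec1_edges S)\<inverse>" for u v
  proof -
    have "f (outD S (i * bn0 S + j)) = f r"
      if "r < bm S" "i < bn0 S" "j < bn0 S" "coefC S i j r \<noteq> 0" for r i j
      using that block_less[of i "bn0 S" j "bn0 S"]
      by (intro computes_colour[OF comp, of f]) (auto simp: col power2_eq_square div_mod_block)
    with that show ?thesis by (auto simp: dec1_edges_def)
  qed
  have "(Inl r, Inr (i, j)) \<in> (dec1_edges S \<union> (dec1_edges S)\<inverse>)\<^sup>*"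
    using S(2) r by (auto simp: dec1_connected_def dec1_verts_def)
  then have "?g (Inl r) = ?g (Inr (i, j))"
    by (induction rule: rtrancl_induct) (use edge in auto)
  then show ?thesis by simp
qed

text \<open>Two entries sharing a slot would agree on all inputs. The matrix units \<open>?A\<close>
  at \<open>(i, 0)\<close> and \<open>?B\<close> at \<open>(0, j)\<close> have as product the matrix
  unit at \<open>(i, j)\<close>, which separates them.\<close>

lemma outD_inj:
  assumes S: "strassen_like S" and ij: "i < bn0 S" "j < bn0 S" "i' < bn0 S" "j' < bn0 S"
    and eq: "outD S (i * bn0 S + j) = outD S (i' * bn0 S + j')"
  shows "i = i' \<and> j = j'"
proof (rule ccontr)
  assume ne: "\<not> (i = i' \<and> j = j')"
  have C: "prog_vals (bm S) (dec S) x ! outD S (i * bn0 S + j) = (\<Sum>r<bm S. coefC S i j r * x r)"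
    if "i < bn0 S" "j < bn0 S" for x i j
    using S that block_less[of i "bn0 S" j "bn0 S"]
    by (auto simp: strassen_like_def computes_def power2_eq_square div_mod_block)
  let ?A = "\<lambda>k l. of_bool (k = i \<and> l = 0) :: real"
  let ?B = "\<lambda>k l. of_bool (k = 0 \<and> l = j) :: real"
  let ?x = "\<lambda>r. (\<Sum>k < bn0 S. \<Sum>l < bn0 S. coefA S r k l * ?A k l)
          * (\<Sum>k < bn0 S. \<Sum>l < bn0 S. coefB S r k l * ?B k l)"
  have "is_mm_alg S" using S by (simp add: strassen_like_def)
  note mm = this[unfolded is_mm_alg_def mult.assoc, rule_format, of _ _ ?A ?B]
  have entries: "(\<Sum>k < bn0 S. ?A i k * ?B k j) = (\<Sum>k < bn0 S. ?A i' k * ?B k j')"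
    using C[of i j ?x] C[of i' j' ?x] mm[of i j] mm[of i' j'] ij eq by simp
  have delta: "(\<Sum>k < bn0 S. ?A a k * ?B k b) = of_bool (a = i \<and> b = j)" for a b
  proof -
    have "(\<Sum>k < bn0 S. ?A a k * ?B k b) = (\<Sum>k < bn0 S. if k = 0 then of_bool (a = i \<and> b = j) else 0)"
      by (intro sum.cong) auto
    then show ?thesis using ij by simp
  qed
  have "(of_bool (i = i \<and> j = j) :: real) = of_bool (i' = i \<and> j' = j)"
    using entries unfolding delta .
  then show False using ne by (auto split: if_splits simp: of_bool_def)
qed

section \<open>The subtree below a recursion node\<close>

text \<open>Paths grow at the front, so the descendants of \<open>ps\<close> are the lists
  \<open>w @ ps\<close>. Encoding vertices are left out: expansion is measured in the decoding graph
  alone.\<close>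

definition subtree :: "nat list \<Rightarrow> vtx set" where
  "subtree ps = {v. \<exists>w t p q. v = Mul (w @ ps) \<or> v = D (w @ ps) t p q}"

lemma subtree_Cons: "subtree (r # ps) \<subseteq> subtree ps"
proof
  fix v assume "v \<in> subtree (r # ps)"
  then obtain w t p q where "v = Mul ((w @ [r]) @ ps) \<or> v = D ((w @ [r]) @ ps) t p q"
    by (auto simp: subtree_def)
  then show "v \<in> subtree ps" unfolding subtree_def by blast
qed

lemma subtree_disjoint: "length ps = length qs \<Longrightarrow> ps \<noteq> qs \<Longrightarrow> subtree ps \<inter> subtree qs = {}"
  by (auto simp: subtree_def)

lemma D_notin_subtree: "D ps t p q \<notin> subtree (r # ps)"
  by (auto simp: subtree_def dest: arg_cong[of _ _ length])

lemma cval_in_subtree: "cval S d ps i j \<in> subtree ps"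
proof (induction d arbitrary: ps i j)
  case 0
  show ?case by (auto simp: subtree_def intro: exI[of _ "[]"])
next
  case (Suc d)
  have "D ps t p q \<in> subtree ps" for t p q
    by (auto simp: subtree_def intro: exI[of _ "[]"])
  with subsetD[OF subtree_Cons Suc] show ?case by (simp add: Let_def)
qed

lemma slotD_in_subtree: "slotD S d ps s p q \<in> subtree ps"
proof -
  have "D ps t p q \<in> subtree ps" for t
    by (auto simp: subtree_def intro: exI[of _ "[]"])
  with subsetD[OF subtree_Cons cval_in_subtree] show ?thesis by (simp add: slotD_def)
qed

text \<open>The position of an entry inside its block selects a copy of the base graph; the block
  selects the output slot of that copy.\<close>

lemma cval_Suc: "cval S (Suc d) ps i j =
   slotD S d ps (outD S ((i div bn0 S ^ d) * bn0 S + j div bn0 S ^ d)) (i mod bn0 S ^ d) (j mod bn0 S ^ d)"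
  by (simp add: slotD_def Let_def)

declare cval.simps(2) [simp del]

text \<open>A vertex can be a slot at several depths, since \<open>outD\<close> may select a bare product;
  only the copies at a fixed depth are disjoint.\<close>

lemma slotD_inj_aux:
  assumes inj: "\<And>r i j i' j'. i < N \<Longrightarrow> j < N \<Longrightarrow> i' < N \<Longrightarrow> j' < N \<Longrightarrow>
       cval S d (r # ps) i j = cval S d (r # ps) i' j' \<Longrightarrow> i = i' \<and> j = j'"
    and pq: "p < N" "q < N" "p' < N" "q' < N"
    and eq: "slotD S d ps s p q = slotD S d ps s' p' q'"
  shows "s = s' \<and> p = p' \<and> q = q'"
proof (cases "s < bm S \<and> s' < bm S")
  case True
  with eq have e: "cval S d (s # ps) p q = cval S d (s' # ps) p' q'" by (simp add: slotD_def)
  then have "s = s'"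
    using cval_in_subtree[of S d "s # ps" p q] cval_in_subtree[of S d "s' # ps" p' q']
      subtree_disjoint[of "s # ps" "s' # ps"] by auto
  with e inj pq show ?thesis by blast
next
  case False
  have "cval S d (r # ps) i j \<noteq> D ps t a b" for r i j t a b
    using cval_in_subtree[of S d "r # ps" i j] D_notin_subtree[of ps t a b r] by auto
  note * = this this[symmetric]
  show ?thesis using False eq * by (auto simp: slotD_def split: if_splits)
qed

text \<open>The vertex determines its slot and the position inside the block, by induction;
  \<open>outD_inj\<close> recovers the block from the slot.\<close>

lemma cval_inj:
  assumes "strassen_like S" "i < bn0 S ^ d" "j < bn0 S ^ d" "i' < bn0 S ^ d" "j' < bn0 S ^ d"
    and "cval S d ps i j = cval S d ps i' j'"
  shows "i = i' \<and> j = j'"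
  using assms(2-)
proof (induction d arbitrary: ps i j i' j')
  case (Suc d)
  let ?N = "bn0 S ^ d"
  have N: "?N > 0" using Suc.prems by (cases "bn0 S = 0") auto
  have lt: "a div ?N < bn0 S" if "a < bn0 S ^ Suc d" for a
    using that by (simp add: less_mult_imp_div_less)
  have eq: "outD S ((i div ?N) * bn0 S + j div ?N) = outD S ((i' div ?N) * bn0 S + j' div ?N) \<and>
     i mod ?N = i' mod ?N \<and> j mod ?N = j' mod ?N"
    using Suc.prems(5) unfolding cval_Suc
    by (intro slotD_inj_aux[of ?N S d ps]) (use Suc.IH N in auto)
  with outD_inj[OF assms(1), of "i div ?N" "j div ?N" "i' div ?N" "j' div ?N"] lt Suc.prems
  have "i div ?N = i' div ?N \<and> j div ?N = j' div ?N" by blast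
  with eq show ?case by (metis div_mult_mod_eq)
qed simp

lemma slotD_inj:
  assumes "strassen_like S" "p < bn0 S ^ d" "q < bn0 S ^ d" "p' < bn0 S ^ d" "q' < bn0 S ^ d"
    and "slotD S d ps s p q = slotD S d ps s' p' q'"
  shows "s = s' \<and> p = p' \<and> q = q'"
  by (rule slotD_inj_aux[OF _ assms(2-)]) (use cval_inj[OF assms(1)] in blast)+

section \<open>Expansion of the decoding graph\<close>

text \<open>The last entry of a relative path is the first choice below the root, so this sorts
  scalar products by child subtree.\<close>

lemma sum_nodes_Suc:
  "(\<Sum>w\<in>nodes S (Suc d). g w) = (\<Sum>r<bm S. \<Sum>w\<in>nodes S d. g (w @ [r]) :: nat)"
proof -
  have "bij_betw (\<lambda>(r, w). w @ [r]) ({..<bm S} \<times> nodes S d) (nodes S (Suc d))"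
  proof (rule bij_betwI')
    fix w assume "w \<in> nodes S (Suc d)"
    then show "\<exists>x\<in>{..<bm S} \<times> nodes S d. w = (case x of (r, w) \<Rightarrow> w @ [r])"
      by (cases w rule: rev_cases) (auto simp: nodes_def)
  qed (auto simp: nodes_def)
  from sum.reindex_bij_betw[OF this, of g] show ?thesis
    by (simp add: sum.cartesian_product case_prod_unfold)
qed

lemma finite_nodes [simp]: "finite (nodes S l)"
  unfolding nodes_def
  by (rule finite_subset[OF _ finite_lists_length_eq[of "{..<bm S}" l]]) auto

lemma card_nodes: "card (nodes S l) = bm S ^ l"
  using card_lists_length_eq[of "{..<bm S}" l] by (simp add: nodes_def conj_commute)

lemma sum_blocks: "(\<Sum>i<n * N. f i) = (\<Sum>a<n. \<Sum>p<N. f (a * N + p) :: nat)" for N :: nat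
proof -
  have "(\<Sum>i<n * N. f i) = (\<Sum>a<n. sum f {a * N..<a * N + N})"
    by (rule sum.nat_group[symmetric])
  also have "\<dots> = (\<Sum>a<n. \<Sum>p<N. f (a * N + p))"
  proof (rule sum.cong[OF refl])
    fix a
    show "sum f {a * N..<a * N + N} = (\<Sum>p<N. f (a * N + p))"
      using sum.shift_bounds_nat_ivl[of f 0 "a * N" N] by (simp add: lessThan_atLeast0 add.commute)
  qed
  finally show ?thesis .
qed

text \<open>The cut that \<open>T\<close> makes in the complete bipartite graph between the scalar
  products and the output entries of the subtree.\<close>

definition mixed_pairs :: "scheme \<Rightarrow> vtx set \<Rightarrow> nat \<Rightarrow> nat list \<Rightarrow> nat" where
  "mixed_pairs S T d ps = (\<Sum>w\<in>nodes S d. \<Sum>i<bn0 S ^ d. \<Sum>j<bn0 S ^ d.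
     of_bool ((Mul (w @ ps) \<in> T) \<noteq> (cval S d ps i j \<in> T)))"

text \<open>Any superset of the two-coloured tails is allowed as \<open>\<delta>\<close>, so that it
  can be the set of resident and moved vertices of a segment.\<close>

definition dec_boundary :: "scheme \<Rightarrow> nat \<Rightarrow> vtx set \<Rightarrow> vtx set \<Rightarrow> bool" where
  "dec_boundary S k T \<delta> \<longleftrightarrow> (\<forall>ps d t p q s. length ps + Suc d = k \<and> ps \<in> nodes S (length ps) \<and>
     t < length (dec S) \<and> p < bn0 S ^ d \<and> q < bn0 S ^ d \<and> s \<in> set (ins_ops (dec S ! t)) \<and>
     (slotD S d ps s p q \<in> T) \<noteq> (D ps t p q \<in> T) \<longrightarrow> slotD S d ps s p q \<in> \<delta>)"

text \<open>Pick one slot in \<open>\<delta>\<close> from each mixed copy. Copies at the same node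
  are disjoint by \<open>slotD_inj\<close>, so the picks are distinct.\<close>

lemma mixed_copies_le:
  fixes S d ps and mixed :: "nat \<Rightarrow> nat \<Rightarrow> bool"
  assumes S: "strassen_like S" and fin: "finite \<delta>"
    and mixed: "\<And>p q. p < bn0 S ^ d \<Longrightarrow> q < bn0 S ^ d \<Longrightarrow> mixed p q \<Longrightarrow>
       \<exists>s. slotD S d ps s p q \<in> \<delta>"
  shows "(\<Sum>p<bn0 S ^ d. \<Sum>q<bn0 S ^ d. of_bool (mixed p q)) \<le> card (\<delta> \<inter> subtree ps)"
proof -
  let ?N = "bn0 S ^ d"
  let ?P = "{(p, q). p < ?N \<and> q < ?N \<and> mixed p q}"
  have "(\<Sum>p<?N. \<Sum>q<?N. of_bool (mixed p q)) = (\<Sum>x\<in>{..<?N} \<times> {..<?N}. of_bool (case_prod mixed x) :: nat)"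
    by (simp add: sum.cartesian_product case_prod_unfold del: sum_of_bool_eq)
  also have "\<dots> = card ?P"
    by (subst sum_of_bool_eq) (simp, simp, rule arg_cong[of _ _ card], auto)
  also have "\<dots> \<le> card (\<delta> \<inter> subtree ps)"
  proof -
    define h where "h = (\<lambda>(p, q). slotD S d ps (SOME s. slotD S d ps s p q \<in> \<delta>) p q)"
    have h: "h (p, q) \<in> \<delta>" if "p < ?N" "q < ?N" "mixed p q" for p q
      using someI_ex[OF mixed[OF that]] by (simp add: h_def)
    have "h (p, q) \<in> subtree ps" for p q
      using slotD_in_subtree by (simp add: h_def)
    with h have "h ` ?P \<subseteq> \<delta> \<inter> subtree ps" by blast
    moreover have "inj_on h ?P"
    proof (rule inj_onI, clarify)
      fix p q p' q'
      assume "p < ?N" "q < ?N" "p' < ?N" "q' < ?N" "h (p, q) = h (p', q')"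
      from slotD_inj[OF S this(1-4) this(5)[unfolded h_def case_prod_conv]]
      show "p = p' \<and> q = q'" by (rule conjunct2)
    qed
    moreover have "finite (\<delta> \<inter> subtree ps)" using fin by simp
    ultimately show ?thesis using card_inj_on_le by blast
  qed
  finally show ?thesis .
qed

text \<open>A mixed pair is either mixed already inside a child subtree or crosses a mixed copy of the base
  graph at \<open>ps\<close>. The constant satisfies the resulting recurrence because \<open>n0\<^sup>2 + 1 \<le> m\<close>.\<close>

lemma mixed_pairs_le:
  assumes S: "strassen_like S" "dec1_connected S" and m: "bn0 S ^ 2 < bm S"
    and fin: "finite \<delta>" and bd: "dec_boundary S k T \<delta>"
    and "length ps + d = k" "ps \<in> nodes S (length ps)"
  shows "mixed_pairs S T d ps \<le> bn0 S ^ 2 * bm S ^ Suc d * card (\<delta> \<inter> subtree ps)"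
  using assms(6,7)
proof (induction d arbitrary: ps)
  case 0
  then show ?case by (simp add: mixed_pairs_def nodes_def)
next
  case (Suc d)
  let ?n = "bn0 S" let ?N = "bn0 S ^ d" let ?m = "bm S"
  let ?x = "card (\<delta> \<inter> subtree ps)"
  define mixed where "mixed p q \<longleftrightarrow> (\<exists>r<?m. \<exists>a<?n. \<exists>b<?n.
     (cval S d (r # ps) p q \<in> T) \<noteq> (slotD S d ps (outD S (a * ?n + b)) p q \<in> T))" for p q
  \<comment> \<open>Without a slot in \<open>\<delta>\<close> no instruction of the copy mixes
    colours, and \<open>dec_colour\<close> makes its products and outputs agree.\<close>
  have mixed: "\<exists>s. slotD S d ps s p q \<in> \<delta>" if pq: "p < ?N" "q < ?N" and mx: "mixed p q" for p q
  proof (rule ccontr)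
    assume none: "\<nexists>s. slotD S d ps s p q \<in> \<delta>"
    let ?f = "\<lambda>s. slotD S d ps s p q \<in> T"
    have "?f s = ?f (?m + t)" if "t < length (dec S)" "s \<in> set (ins_ops (dec S ! t))" for t s
    proof -
      have "(slotD S d ps s p q \<in> T) = (D ps t p q \<in> T)"
        using bd none that pq Suc.prems unfolding dec_boundary_def by blast
      then show ?thesis by (simp add: slotD_def)
    qed
    then have "?f (outD S (a * ?n + b)) = ?f r" if "r < ?m" "a < ?n" "b < ?n" for r a b
      using that by (intro dec_colour[OF S, of ?f])
    then show False using mx by (auto simp: mixed_def slotD_def)
  qed
  \<comment> \<open>A pair mixed inside a child is counted once per block \<open>(a, b)\<close>; a
    mixed copy is charged for all \<open>?n ^ 2 * (?m * card W)\<close> pairs routed through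
    it.\<close>
  have expand: "(\<Sum>r<?m. \<Sum>w\<in>W. \<Sum>a<?n. \<Sum>p<?N. \<Sum>b<?n. \<Sum>q<?N. f r w p q + g p q) =
      ?n ^ 2 * (\<Sum>r<?m. \<Sum>w\<in>W. \<Sum>p<?N. \<Sum>q<?N. f r w p q) +
      ?n ^ 2 * (?m * card W) * (\<Sum>p<?N. \<Sum>q<?N. g p q)"
    for f :: "nat \<Rightarrow> nat list \<Rightarrow> nat \<Rightarrow> nat \<Rightarrow> nat" and g W
    by (simp add: sum.distrib distrib_left power2_eq_square mult.assoc mult.left_commute
        flip: sum_distrib_left)
  have "mixed_pairs S T (Suc d) ps =
    (\<Sum>r<?m. \<Sum>w\<in>nodes S d. \<Sum>a<?n. \<Sum>p<?N. \<Sum>b<?n. \<Sum>q<?N.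
      of_bool ((Mul (w @ r # ps) \<in> T) \<noteq> (slotD S d ps (outD S (a * ?n + b)) p q \<in> T)))"
    unfolding mixed_pairs_def sum_nodes_Suc power_Suc sum_blocks
    by (intro sum.cong refl) (simp add: cval_Suc)
  \<comment> \<open>Route the pair through entry \<open>(p, q)\<close> of the child
    \<open>r # ps\<close>: either the scalar product differs in colour from that entry, or the entry
    differs from the output and copy \<open>(p, q)\<close> is mixed.\<close>
  also have "\<dots> \<le> (\<Sum>r<?m. \<Sum>w\<in>nodes S d. \<Sum>a<?n. \<Sum>p<?N. \<Sum>b<?n. \<Sum>q<?N.
      of_bool ((Mul (w @ r # ps) \<in> T) \<noteq> (cval S d (r # ps) p q \<in> T)) + of_bool (mixed p q))"
  proof (intro sum_mono)
    fix r w a p b q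
    assume "r \<in> {..<?m}" "a \<in> {..<?n}" "b \<in> {..<?n}"
    then have "mixed p q"
      if "(cval S d (r # ps) p q \<in> T) \<noteq> (slotD S d ps (outD S (a * ?n + b)) p q \<in> T)"
      using that by (auto simp only: mixed_def lessThan_iff)
    then show "of_bool ((Mul (w @ r # ps) \<in> T) \<noteq> (slotD S d ps (outD S (a * ?n + b)) p q \<in> T)) \<le>
        of_bool ((Mul (w @ r # ps) \<in> T) \<noteq> (cval S d (r # ps) p q \<in> T)) + (of_bool (mixed p q) :: nat)"
      by (auto simp: of_bool_def)
  qed
  also have "\<dots> = ?n ^ 2 * (\<Sum>r<?m. mixed_pairs S T d (r # ps)) +
      ?n ^ 2 * ?m ^ Suc d * (\<Sum>p<?N. \<Sum>q<?N. of_bool (mixed p q))"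
    unfolding expand mixed_pairs_def by (simp add: card_nodes)
  also have "(\<Sum>p<?N. \<Sum>q<?N. of_bool (mixed p q)) \<le> ?x"
    by (rule mixed_copies_le[OF S(1) fin mixed])
  also have "(\<Sum>r<?m. mixed_pairs S T d (r # ps)) \<le>
      (\<Sum>r<?m. ?n ^ 2 * ?m ^ Suc d * card (\<delta> \<inter> subtree (r # ps)))"
    using Suc.prems by (intro sum_mono Suc.IH) (auto simp: nodes_def)
  also have "\<dots> = ?n ^ 2 * ?m ^ Suc d * card (\<Union>r<?m. \<delta> \<inter> subtree (r # ps))"
    using fin subtree_disjoint[of "_ # ps" "_ # ps"]
    by (subst card_UN_disjoint) (auto simp: sum_distrib_left)
  also have "card (\<Union>r<?m. \<delta> \<inter> subtree (r # ps)) \<le> ?x"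
    using fin subtree_Cons by (intro card_mono) auto
  also have "?n ^ 2 * (?n ^ 2 * ?m ^ Suc d * ?x) + ?n ^ 2 * ?m ^ Suc d * ?x
      = (?n ^ 2 + 1) * (?n ^ 2 * ?m ^ Suc d * ?x)"
    by (simp add: algebra_simps)
  also have "\<dots> \<le> ?m * (?n ^ 2 * ?m ^ Suc d * ?x)"
    using m by (intro mult_le_mono1) simp
  finally show ?case by (simp add: mult_ac)
qed

text \<open>Each output entry is mixed with all products of the other colour, and by assumption the
  products in \<open>T\<close> are the smaller class.\<close>

lemma mixed_pairs_ge:
  assumes "2 * card {w \<in> nodes S d. Mul (w @ ps) \<in> T} \<le> bm S ^ d"
  shows "card {w \<in> nodes S d. Mul (w @ ps) \<in> T} * bn0 S ^ (2 * d) \<le> mixed_pairs S T d ps"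
proof -
  let ?X = "{w \<in> nodes S d. Mul (w @ ps) \<in> T}" let ?N = "bn0 S ^ d"
  have split: "nodes S d - ?X = {w \<in> nodes S d. Mul (w @ ps) \<notin> T}" by auto
  have "card (nodes S d - ?X) = bm S ^ d - card ?X"
    by (subst card_Diff_subset) (auto simp: card_nodes)
  then have compl: "card ?X \<le> card {w \<in> nodes S d. Mul (w @ ps) \<notin> T}"
    using assms split by simp
  have "card ?X * bn0 S ^ (2 * d) = (\<Sum>i<?N. \<Sum>j<?N. card ?X)"
    by (simp add: power_mult power2_eq_square mult_2 power_add)
  also have "\<dots> \<le> (\<Sum>i<?N. \<Sum>j<?N. \<Sum>w\<in>nodes S d. of_bool ((Mul (w @ ps) \<in> T) \<noteq> (cval S d ps i j \<in> T)))"
  proof (intro sum_mono)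
    fix i j
    show "card ?X \<le> (\<Sum>w\<in>nodes S d. of_bool ((Mul (w @ ps) \<in> T) \<noteq> (cval S d ps i j \<in> T)))"
      using compl by (cases "cval S d ps i j \<in> T") (simp_all add: Int_def)
  qed
  also have "\<dots> = mixed_pairs S T d ps"
    unfolding mixed_pairs_def sum.swap[of _ "nodes S d" "{..<?N}"] by (rule refl)
  finally show ?thesis .
qed

section \<open>Summation over all subtrees of depth \<open>d\<close>\<close>

lemma card_Mul_eq:
  assumes "d \<le> k"
  shows "card (Mul ` nodes S k \<inter> T) =
    (\<Sum>ps\<in>nodes S (k - d). card {w \<in> nodes S d. Mul (w @ ps) \<in> T})"
proof -
  let ?A = "SIGMA ps:nodes S (k - d). {w \<in> nodes S d. Mul (w @ ps) \<in> T}"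
  let ?h = "\<lambda>(ps, w). Mul (w @ ps)"
  have inj: "inj_on ?h ?A"
  proof (rule inj_onI, clarify)
    fix ps w ps' w'
    assume "ps \<in> nodes S (k - d)" "ps' \<in> nodes S (k - d)" "w @ ps = w' @ ps'"
    moreover from this have "length ps = length ps'" by (simp add: nodes_def)
    ultimately show "ps = ps' \<and> w = w'" by simp
  qed
  have img: "?h ` ?A = Mul ` nodes S k \<inter> T"
  proof
    have "w @ ps \<in> nodes S k" if "w \<in> nodes S d" "ps \<in> nodes S (k - d)" for w ps
      using that assms by (simp add: nodes_def)
    then show "?h ` ?A \<subseteq> Mul ` nodes S k \<inter> T" by auto
    show "Mul ` nodes S k \<inter> T \<subseteq> ?h ` ?A"
    proof
      fix v assume "v \<in> Mul ` nodes S k \<inter> T"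
      then obtain w where w: "w \<in> nodes S k" "v = Mul w" "v \<in> T" by blast
      then have "take d w \<in> nodes S d" "drop d w \<in> nodes S (k - d)"
        using assms set_take_subset[of d w] set_drop_subset[of d w] unfolding nodes_def by force+
      moreover have "v = ?h (drop d w, take d w)" using w by simp
      ultimately show "v \<in> ?h ` ?A" using w by (intro image_eqI[of _ _ "(drop d w, take d w)"]) simp_all
    qed
  qed
  have "card (Mul ` nodes S k \<inter> T) = card ?A"
    using card_image[OF inj] unfolding img .
  also have "\<dots> = (\<Sum>ps\<in>nodes S (k - d). card {w \<in> nodes S d. Mul (w @ ps) \<in> T})"
    by (rule card_SigmaI) simp_all
  finally show ?thesis .
qed

lemma boundary_large:
  assumes S: "strassen_like S" "dec1_connected S" and m: "bn0 S ^ 2 < bm S"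
    and fin: "finite \<delta>" and bd: "dec_boundary S k T \<delta>" and d: "d \<le> k"
    and half: "2 * card (Mul ` nodes S k \<inter> T) \<le> bm S ^ d"
  shows "card (Mul ` nodes S k \<inter> T) * bn0 S ^ (2 * d) \<le> bn0 S ^ 2 * bm S ^ Suc d * card \<delta>"
proof -
  let ?X = "\<lambda>ps. card {w \<in> nodes S d. Mul (w @ ps) \<in> T}"
  note total = card_Mul_eq[OF d, of S T]
  \<comment> \<open>All products in \<open>T\<close> together are at most half of one subtree, so
    \<open>mixed_pairs_ge\<close> applies however they are distributed.\<close>
  have X: "2 * ?X ps \<le> bm S ^ d" if "ps \<in> nodes S (k - d)" for ps
    using member_le_sum[of ps "nodes S (k - d)" ?X] that half total by simp
  have "card (Mul ` nodes S k \<inter> T) * bn0 S ^ (2 * d) = (\<Sum>ps\<in>nodes S (k - d). ?X ps * bn0 S ^ (2 * d))"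
    by (simp add: total sum_distrib_right)
  also have "\<dots> \<le> (\<Sum>ps\<in>nodes S (k - d). bn0 S ^ 2 * bm S ^ Suc d * card (\<delta> \<inter> subtree ps))"
  proof (rule sum_mono)
    fix ps assume ps: "ps \<in> nodes S (k - d)"
    then have "length ps + d = k" "ps \<in> nodes S (length ps)" using d by (auto simp: nodes_def)
    from order_trans[OF mixed_pairs_ge[OF X[OF ps]] mixed_pairs_le[OF S m fin bd this]]
    show "?X ps * bn0 S ^ (2 * d) \<le> bn0 S ^ 2 * bm S ^ Suc d * card (\<delta> \<inter> subtree ps)" .
  qed
  also have "\<dots> = bn0 S ^ 2 * bm S ^ Suc d * card (\<Union>ps\<in>nodes S (k - d). \<delta> \<inter> subtree ps)"
  proof -
    have "card (\<Union>ps\<in>nodes S (k - d). \<delta> \<inter> subtree ps) = (\<Sum>ps\<in>nodes S (k - d). card (\<delta> \<inter> subtree ps))"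
    proof (rule card_UN_disjoint)
      show "\<forall>ps\<in>nodes S (k - d). \<forall>qs\<in>nodes S (k - d). ps \<noteq> qs \<longrightarrow>
          \<delta> \<inter> subtree ps \<inter> (\<delta> \<inter> subtree qs) = {}"
      proof (intro ballI impI)
        fix ps qs assume "ps \<in> nodes S (k - d)" "qs \<in> nodes S (k - d)" "ps \<noteq> qs"
        then have "subtree ps \<inter> subtree qs = {}" by (intro subtree_disjoint) (auto simp: nodes_def)
        then show "\<delta> \<inter> subtree ps \<inter> (\<delta> \<inter> subtree qs) = {}" by blast
      qed
    qed (use fin in auto)
    then show ?thesis by (simp add: sum_distrib_left)
  qed
  also have "\<dots> \<le> bn0 S ^ 2 * bm S ^ Suc d * card \<delta>"
    using fin by (intro mult_le_mono2 card_mono) auto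
  finally show ?thesis .
qed

section \<open>The lower bound for a fixed subtree depth\<close>

lemma cdag_boundary:
  assumes "\<And>u v. v \<in> cdag_V S k - cdag_I S k \<Longrightarrow> u \<in> cdag_preds S k v - cdag_I S k \<Longrightarrow>
     (u \<in> T) \<noteq> (v \<in> T) \<Longrightarrow> u \<in> \<delta>"
  shows "dec_boundary S k T \<delta>"
  unfolding dec_boundary_def
proof (intro allI impI, elim conjE)
  fix ps d t p q s
  assume *: "length ps + Suc d = k" "ps \<in> nodes S (length ps)" "t < length (dec S)"
    "p < bn0 S ^ d" "q < bn0 S ^ d" "s \<in> set (ins_ops (dec S ! t))"
    "(slotD S d ps s p q \<in> T) \<noteq> (D ps t p q \<in> T)"
  have d: "d = k - Suc (length ps)" using * by simp
  have "D ps t p q \<in> cdag_V S k - cdag_I S k"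
    using * d by (auto simp: cdag_V_def cdag_I_def)
  moreover have "slotD S d ps s p q \<in> cdag_preds S k (D ps t p q)"
    using * d by simp
  moreover have "slotD S d ps s p q \<notin> cdag_I S k"
    using slotD_in_subtree[of S d ps s p q] by (auto simp: cdag_I_def subtree_def)
  ultimately show "slotD S d ps s p q \<in> \<delta>" using assms *(7) by blast
qed

text \<open>Each segment computes half of the products of one subtree, rounded down. The constant
  \<open>12\<close> is \<open>3\<close>, for the \<open>3 * M\<close> boundary vertices, times
  \<open>4\<close>, for the rounded half.\<close>

lemma io_cost_ge:
  assumes S: "strassen_like S" "dec1_connected S" and m: "bn0 S ^ 2 < bm S"
    and d: "0 < d" "d \<le> k" and M: "12 * bn0 S ^ 2 * bm S * M \<le> bn0 S ^ (2 * d)"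
    and valid: "valid_impl M (cdag_V S k) (cdag_I S k) (cdag_O S k) (cdag_preds S k) sch"
    and n: "0 < bn0 S"
  shows "bm S ^ (k - d) * M \<le> io_cost sch"
proof (rule io_lower_bound[OF valid, where L = "Mul ` nodes S k" and K = "bm S ^ d div 2"])
  let ?m = "bm S" let ?K = "bm S ^ d div 2"
  show "finite (Mul ` nodes S k)" by simp
  show "Mul ` nodes S k \<subseteq> cdag_V S k - cdag_I S k" by (auto simp: cdag_V_def cdag_I_def)
  have "card (Mul ` nodes S k) = ?m ^ k"
    by (subst card_image) (auto simp: inj_on_def card_nodes)
  also have "\<dots> = ?m ^ (k - d) * ?m ^ d" using d by (simp flip: power_add)
  finally show "?m ^ (k - d) * ?K \<le> card (Mul ` nodes S k)" by simp
  fix T \<delta>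
  assume K: "card (Mul ` nodes S k \<inter> T) = ?K" and fin: "finite (\<delta> :: vtx set)"
    and bd: "\<And>u v. v \<in> cdag_V S k - cdag_I S k \<Longrightarrow> u \<in> cdag_preds S k v - cdag_I S k \<Longrightarrow>
     (u \<in> T) \<noteq> (v \<in> T) \<Longrightarrow> u \<in> \<delta>"
  have "dec_boundary S k T \<delta>" using bd by (rule cdag_boundary)
  then have "?K * bn0 S ^ (2 * d) \<le> bn0 S ^ 2 * ?m ^ Suc d * card \<delta>"
    using boundary_large[OF S m fin _ d(2), of T] K by simp
  \<comment> \<open>Rounding down loses at most a further factor \<open>2\<close>, because
    \<open>0 < d\<close> makes \<open>?m ^ d\<close> at least \<open>2\<close>.\<close>
  moreover have "?m ^ d \<le> 4 * ?K"
  proof -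
    have "0 < bn0 S ^ 2" using n by simp
    with m have "2 \<le> ?m" by linarith
    also have "?m ^ 1 \<le> ?m ^ d" using d calculation by (intro power_increasing) auto
    finally show ?thesis by simp
  qed
  ultimately have "?m ^ d * bn0 S ^ (2 * d) \<le> 4 * (bn0 S ^ 2 * ?m ^ Suc d * card \<delta>)"
    using mult_le_mono1[of "?m ^ d" "4 * ?K" "bn0 S ^ (2 * d)"] by linarith
  moreover have "?m ^ d * (12 * bn0 S ^ 2 * ?m * M) \<le> ?m ^ d * bn0 S ^ (2 * d)"
    using M by (rule mult_le_mono2)
  ultimately have "?m ^ d * (12 * bn0 S ^ 2 * ?m * M) \<le> 4 * (bn0 S ^ 2 * ?m ^ Suc d * card \<delta>)"
    by linarith
  then have "(4 * bn0 S ^ 2 * ?m ^ Suc d) * (3 * M) \<le> (4 * bn0 S ^ 2 * ?m ^ Suc d) * card \<delta>"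
    by (simp add: algebra_simps)
  then show "3 * M \<le> card \<delta>" using m n by simp
qed

section \<open>The choice of depth and constants\<close>

theorem theorem2:
  fixes S :: scheme
  assumes "strassen_like S"
    and "2 < log (bn0 S) (bm S)" and "log (bn0 S) (bm S) < 3"
    and "dec1_connected S"
  shows "\<exists>c c0 :: real. c > 0 \<and> c0 \<ge> 1 \<and>
    (\<forall>(M::nat) (k::nat) (sch :: vtx step list).
       M \<ge> 1 \<and> real (bn0 S ^ k) \<ge> c0 * sqrt (real M) \<and>
       valid_impl M (cdag_V S k) (cdag_I S k) (cdag_O S k) (cdag_preds S k) sch
       \<longrightarrow> real (io_cost sch) \<ge>
             c * (real (bn0 S ^ k) / sqrt (real M)) powr (log (bn0 S) (bm S)) * real M)"
proof -
  define n m \<omega> where "n = bn0 S" and "m = bm S" and "\<omega> = log n m"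
  \<comment> \<open>Logarithms to base \<open>0\<close> and \<open>1\<close> have the default value
    \<open>0\<close>, against the lower bound on the exponent.\<close>
  have n: "2 \<le> n"
  proof (rule ccontr)
    assume "\<not> 2 \<le> n"
    then have "n = 0 \<or> n = 1" by auto
    then show False using assms(2) by (auto simp: n_def log_def)
  qed
  have m0: "0 < m" using assms(2) by (cases "bm S = 0") (auto simp: log_def m_def)
  have "real n powr 2 < real m"
    using assms(2) n m0 by (simp add: less_log_iff n_def m_def)
  then have "real (n ^ 2) < real m" using n by simp
  then have m: "n ^ 2 < m" by linarith
  define C where "C = 12 * n ^ 2 * m"
  have "0 < n ^ 2 * m" using n m0 by simp
  then have C: "1 < C" unfolding C_def by linarith
  \<comment> \<open>With this \<open>c0\<close> the depth \<open>k\<close> itself satisfies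
    \<open>C * M \<le> n ^ (2 * k)\<close>; \<open>c\<close> absorbs \<open>c0\<close> and the
    factor \<open>n\<close> by which the least suitable depth may overshoot.\<close>
  define c0 where "c0 = sqrt (real C)"
  define c where "c = (1 / (real n * c0)) powr \<omega>"
  have c0: "1 \<le> c0" using C by (simp add: c0_def)
  have "real (io_cost sch) \<ge> c * (real (n ^ k) / sqrt (real M)) powr \<omega> * real M"
    if M: "M \<ge> 1" and k: "real (n ^ k) \<ge> c0 * sqrt (real M)"
      and valid: "valid_impl M (cdag_V S k) (cdag_I S k) (cdag_O S k) (cdag_preds S k) sch"
    for M k :: nat and sch
  proof -
    have "sqrt (real (C * M)) \<le> real (n ^ k)" using k by (simp add: c0_def real_sqrt_mult)
    then have "real (C * M) \<le> (real (n ^ k))\<^sup>2" by (rule sqrt_le_D)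
    also have "\<dots> = real (n ^ (2 * k))" by (simp add: power_even_eq)
    finally have ex: "C * M \<le> n ^ (2 * k)" by (simp only: of_nat_le_iff)
    \<comment> \<open>The least depth whose subtrees are large enough. Minimality bounds
      \<open>n ^ d\<close> by \<open>n * sqrt (C * M)\<close>, which keeps the number
      \<open>m ^ (k - d)\<close> of segments large.\<close>
    define d where "d = (LEAST d. C * M \<le> n ^ (2 * d))"
    have d: "C * M \<le> n ^ (2 * d)" unfolding d_def using ex by (rule LeastI)
    have dk: "d \<le> k" unfolding d_def using ex by (rule Least_le)
    have "C * 1 \<le> C * M" using M by (rule mult_le_mono2)
    then have "1 < C * M" using C by linarith
    with d have d0: "0 < d" by (cases d) auto
    then obtain e where e: "d = Suc e" by (cases d) auto
    then have "e < (LEAST d. C * M \<le> n ^ (2 * d))" by (simp flip: d_def)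
    then have "\<not> C * M \<le> n ^ (2 * e)" by (rule not_less_Least)
    then have "real (n ^ e) \<le> sqrt (real (C * M))"
      by (intro real_le_rsqrt) (simp add: mult.commute flip: power_mult of_nat_power of_nat_mult)
    then have "real (n ^ d) \<le> real n * c0 * sqrt (real M)"
      using n by (simp add: e c0_def real_sqrt_mult)
    moreover have "real (n ^ k) = real (n ^ (k - d)) * real (n ^ d)"
      using dk by (simp flip: power_add)
    ultimately have "real (n ^ k) \<le> real (n ^ (k - d)) * (real n * c0 * sqrt (real M))"
      by (simp add: mult_left_mono)
    then have le: "1 / (real n * c0) * (real (n ^ k) / sqrt (real M)) \<le> real (n ^ (k - d))"
      using n c0 M by (simp add: field_simps)
    have "c * (real (n ^ k) / sqrt (real M)) powr \<omega> =
        (1 / (real n * c0) * (real (n ^ k) / sqrt (real M))) powr \<omega>"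
      unfolding c_def using c0 by (subst powr_mult) auto
    also have "\<dots> \<le> real (n ^ (k - d)) powr \<omega>"
      using le c0 assms(2) by (intro powr_mono2) (auto simp: \<omega>_def n_def m_def)
    also have "\<dots> = (real n powr \<omega>) ^ (k - d)"
      using n by (simp add: powr_powr mult.commute flip: powr_realpow)
    also have "real n powr \<omega> = real m"
      unfolding \<omega>_def using n m0 by simp
    finally have "c * (real (n ^ k) / sqrt (real M)) powr \<omega> * real M \<le> real (m ^ (k - d) * M)"
      by (simp add: mult_right_mono)
    also have "m ^ (k - d) * M \<le> io_cost sch"
      using io_cost_ge[OF assms(1,4) m[unfolded n_def m_def] d0 dk _ valid] d n
      by (simp add: C_def n_def m_def)
    finally show ?thesis by simp
  qed
  moreover have "c > 0" using c0 n by (simp add: c_def)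
  ultimately show ?thesis using c0 unfolding n_def m_def \<omega>_def by blast
qed

end
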